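(* Let $n\ge 0$ and $k\ge 1$ be integers. The number of $12312$-avoiding partitions of $[n+1]$ with exactly $k+1$ blocks is equal to $$\sum_{j=k}^{n}\frac{1}{j}\binom{j}{k-1}\binom{j}{k}\binom{n}{j},$$ and the number of $12321$-avoiding partitions of $[n+1]$ with exactly $k+1$ blocks is equal to the same sum.
   Context: A partition of $[m]=\{1,\dots,m\}$ with blocks $B_1,\dots,B_r$ (nonempty, disjoint, with union $[m]$), listed so that $\min B_1<\min B_2<\cdots<\min B_r$, is represented by its canonical sequential form: the word $\pi_1\pi_2\cdots\pi_m$ on $\{1,\dots,r\}$ with $\pi_i=j$ if and only if $i\in B_j$. A partition $\pi$ avoids a partition (pattern) $\tau$ if the word $\pi$ has no (not necessarily contiguous) subsequence order-isomorphic to $\tau$. An empty sum (when $k>n$) equals $0$. *)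

theory Defs
  imports Complex_Main "HOL-Library.Disjoint_Sets" "HOL-Library.Sublist"
begin

text \<open>
  A partition of \<open>{1..m}\<close> is a set of blocks, as in \<^const>\<open>partition_on\<close>. The index of a block
  is its rank when the blocks are listed by increasing minimum, counted from 1; the lemma
  \<open>canonical_word_nth\<close> below states this in terms of such a listing.
\<close>

definition block_index :: "nat set set \<Rightarrow> nat set \<Rightarrow> nat" where
  "block_index P B = card {C \<in> P. Min C \<le> Min B}"

definition canonical_word :: "nat \<Rightarrow> nat set set \<Rightarrow> nat list" where
  "canonical_word m P = map (\<lambda>i. block_index P (THE B. B \<in> P \<and> i \<in> B)) [1..<Suc m]"

definition order_isomorphic :: "nat list \<Rightarrow> nat list \<Rightarrow> bool" where
  "order_isomorphic u v \<longleftrightarrow>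
     length u = length v \<and>
     (\<forall>i<length u. \<forall>j<length u. u ! i < u ! j \<longleftrightarrow> v ! i < v ! j)"

text \<open>\<^const>\<open>subseq\<close> is the not necessarily contiguous subsequence relation.\<close>

definition avoids :: "nat list \<Rightarrow> nat list \<Rightarrow> bool" where
  "avoids w \<tau> \<longleftrightarrow> \<not> (\<exists>u. subseq u w \<and> order_isomorphic u \<tau>)"

definition avoiding_partitions :: "nat list \<Rightarrow> nat \<Rightarrow> nat \<Rightarrow> nat set set set" where
  "avoiding_partitions \<tau> m r =
     {P. partition_on {1..m} P \<and> card P = r \<and> avoids (canonical_word m P) \<tau>}"

lemma canonical_word_nth:
  fixes B :: "nat \<Rightarrow> nat set"
  assumes P: "partition_on {1..m} P" and B: "bij_betw B {1..r} P"
    and ordered: "\<And>a b. a \<in> {1..r} \<Longrightarrow> b \<in> {1..r} \<Longrightarrow> a < b \<Longrightarrow> Min (B a) < Min (B b)"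
    and i: "i \<in> {1..m}" and j: "j \<in> {1..r}"
  shows "canonical_word m P ! (i - 1) = j \<longleftrightarrow> i \<in> B j"
proof -
  have idx: "block_index P (B a) = a" if a: "a \<in> {1..r}" for a
  proof -
    have le: "Min (B c) \<le> Min (B a) \<longleftrightarrow> c \<le> a" if "c \<in> {1..r}" for c
      using ordered[OF that a] ordered[OF a that] by (cases c a rule: linorder_cases) auto
    have "{C \<in> P. Min C \<le> Min (B a)} = B ` {1..a}"
      using B le a by (auto simp: bij_betw_def)
    moreover have "inj_on B {1..a}"
      using a by (intro inj_on_subset[OF bij_betw_imp_inj_on[OF B]]) auto
    ultimately show ?thesis
      by (simp add: block_index_def card_image)
  qed
  obtain C where C: "C \<in> P" "i \<in> C"
    using P i partition_onD1 by blast
  have the: "(THE D. D \<in> P \<and> i \<in> D) = D" if "D \<in> P" "i \<in> D" for D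
    using that P by (intro the_equality) (auto simp: partition_on_def disjoint_def)
  obtain c where c: "c \<in> {1..r}" "C = B c"
    using C B by (auto simp: bij_betw_def)
  have nth: "canonical_word m P ! (i - 1) = c"
  proof -
    have "canonical_word m P ! (i - 1) = block_index P (THE D. D \<in> P \<and> i \<in> D)"
      using i unfolding canonical_word_def by (subst nth_map_upt) auto
    also have "\<dots> = c"
      unfolding the[OF C] c(2) by (rule idx[OF c(1)])
    finally show ?thesis .
  qed
  show ?thesis
  proof
    assume "canonical_word m P ! (i - 1) = j"
    with nth C c show "i \<in> B j" by simp
  next
    assume "i \<in> B j"
    have "B j \<in> P" using B j by (auto simp: bij_betw_def)
    then have "B j = B c"
      using the[OF _ \<open>i \<in> B j\<close>] the[OF C] c(2) by simp
    then have "j = c"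
      using B j c(1) by (meson bij_betw_imp_inj_on inj_onD)
    with nth show "canonical_word m P ! (i - 1) = j" by simp
  qed
qed

end

theory Submission
  imports Defs
begin

text \<open>
  A canonical word is a restricted growth word, so in front of a letter \<open>c\<close> all smaller letters
  occur in increasing order. Hence the prefix \<open>12\<close> of the patterns is for free: avoiding \<open>12312\<close>
  (or \<open>12321\<close>) means avoiding \<open>312\<close> (or \<open>321\<close>). Build such words letter by letter. To a word with
  maximum \<open>r\<close> one may append \<open>r\<close>, \<open>r + 1\<close>, or one of \<open>g\<close> admissible smaller letters. For both
  patterns, \<open>r\<close> keeps \<open>g\<close>, \<open>r + 1\<close> raises it by one, and the smaller letters lead to the values
  \<open>1, \<dots>, g\<close>, once each. So both numbers count the same lattice walks starting at \<open>g = 0\<close>.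
  Deleting the steps that append \<open>r\<close> turns the count into a binomial transform, and the
  remaining walks with \<open>j\<close> steps have a closed form, which at \<open>g = 0\<close> is the Narayana number
  \<open>(1 / j) (j choose (k - 1)) (j choose k)\<close>.
\<close>

subsection \<open>Lattice walks\<close>

text \<open>
  \<open>lazy_walks n k g\<close> counts the walks of \<open>n\<close> steps with \<open>k\<close> up-steps from height \<open>g\<close>: an up-step
  raises the height by one, a lazy step keeps it, and any other step goes to a height in
  \<open>{1..g}\<close>, possibly \<open>g\<close> again. In \<open>walks\<close> the lazy steps are left out.
\<close>

primrec lazy_walks :: "nat \<Rightarrow> nat \<Rightarrow> nat \<Rightarrow> nat" where
  "lazy_walks 0 k g = (if k = 0 then 1 else 0)"
| "lazy_walks (Suc n) k g =
     (case k of 0 \<Rightarrow> 0 | Suc k' \<Rightarrow> lazy_walks n k' (Suc g)) + lazy_walks n k g + (\<Sum>i=1..g. lazy_walks n k i)"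

primrec walks :: "nat \<Rightarrow> nat \<Rightarrow> nat \<Rightarrow> nat" where
  "walks 0 k g = (if k = 0 then 1 else 0)"
| "walks (Suc n) k g =
     (case k of 0 \<Rightarrow> 0 | Suc k' \<Rightarrow> walks n k' (Suc g)) + (\<Sum>i=1..g. walks n k i)"

text \<open>Pascal's rule, summed against \<open>m\<close>. It is the recursion in \<open>n\<close>
  of a binomial transform: the second sum is the transform of the shifted sequence.\<close>

lemma binomial_sum_Suc:
  fixes m :: "nat \<Rightarrow> nat"
  shows "(\<Sum>j\<le>Suc n. (Suc n choose j) * m j) =
    (\<Sum>j\<le>n. (n choose j) * m j) + (\<Sum>j\<le>n. (n choose j) * m (Suc j))"
proof -
  have "(\<Sum>j\<le>Suc n. (Suc n choose j) * m j) = m 0 + (\<Sum>j\<le>n. (n choose Suc j) * m (Suc j)) + (\<Sum>j\<le>n. (n choose j) * m (Suc j))"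
    by (subst sum.atMost_Suc_shift) (simp add: algebra_simps sum.distrib)
  \<comment> \<open>The extra term \<open>j = Suc n\<close> is zero, since
    \<open>n choose Suc n = 0\<close>.\<close>
  also have "m 0 + (\<Sum>j\<le>n. (n choose Suc j) * m (Suc j)) = (\<Sum>j\<le>Suc n. (n choose j) * m j)"
    by (subst sum.atMost_Suc_shift) simp
  finally show ?thesis by simp
qed

text \<open>Lazy steps do not change the height, so a walk of \<open>n\<close> steps amounts to the
  positions of its \<open>j\<close> other steps together with a walk made of those. In the induction
  the two sums of \<open>binomial_sum_Suc\<close> belong to a lazy and to a non-lazy first
  step.\<close>

lemma lazy_walks_eq_binomial_transform:
  "lazy_walks n k g = (\<Sum>j\<le>n. (n choose j) * walks j k g)"
proof (induction n arbitrary: k g)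
  case (Suc n)
  have "(\<Sum>i=1..g. lazy_walks n k i) = (\<Sum>j\<le>n. (n choose j) * (\<Sum>i=1..g. walks j k i))"
    unfolding Suc sum_distrib_left by (rule sum.swap)
  moreover have "(case k of 0 \<Rightarrow> 0 | Suc k' \<Rightarrow> lazy_walks n k' (Suc g)) =
      (\<Sum>j\<le>n. (n choose j) * (case k of 0 \<Rightarrow> 0 | Suc k' \<Rightarrow> walks j k' (Suc g)))"
    by (cases k) (simp_all add: Suc)
  ultimately show ?case
    unfolding binomial_sum_Suc by (simp add: Suc.IH sum.distrib distrib_left)
qed simp

text \<open>The case \<open>k = 0\<close> is split off because the factor \<open>j choose (k - 1)\<close> has to vanish there.\<close>

lemma walks_closed:
  "int (walks j k (Suc h)) =
    int (j choose k) * int (h + j choose (h + k)) -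
    (case k of 0 \<Rightarrow> 0 | Suc k' \<Rightarrow> int (j choose k')) * int (h + j choose Suc (h + k))"
proof (induction j arbitrary: k h)
  case 0
  show ?case by (cases k) auto
next
  case (Suc j)
  note outer_IH = Suc.IH
  show ?case
  proof (induction h)
    case 0
    \<comment> \<open>The formula distinguishes \<open>k = 0\<close>, and so does its instance for
      the predecessor of \<open>k\<close> after an up-step; hence three cases.\<close>
    consider "k = 0" | "k = Suc 0" | l where "k = Suc (Suc l)"
      by (metis not0_implies_Suc)
    then show ?case
      by cases (simp_all add: Suc.IH algebra_simps)
  next
    case (Suc h)
    note IH = Suc.IH
    \<comment> \<open>Difference of the recursions at two consecutive heights: of the sum only its
      top summand survives, so nothing has to be summed in closed form.\<close>
    have step: "int (walks (Suc j) k (Suc (Suc h))) = int (walks (Suc j) k (Suc h)) +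
      (case k of 0 \<Rightarrow> 0 | Suc k' \<Rightarrow> int (walks j k' (Suc (Suc (Suc h)))) - int (walks j k' (Suc (Suc h)))) +
      int (walks j k (Suc (Suc h)))"
      by (simp split: nat.split)
    consider "k = 0" | "k = Suc 0" | l where "k = Suc (Suc l)"
      by (metis not0_implies_Suc)
    then show ?case
      unfolding step IH outer_IH
      by cases (simp_all add: algebra_simps)
  qed
qed

text \<open>By absorption \<open>y\<close> and \<open>z\<close> are rational multiples of
  \<open>x\<close>, which leaves a rational identity in \<open>j\<close> and \<open>k\<close>. By
  Pascal's rule the right side is the product of \<open>Suc j choose k\<close> and
  \<open>Suc j choose Suc k\<close>.\<close>

lemma narayana_eq:
  fixes j k :: nat
  defines "x \<equiv> real (j choose k)" and "z \<equiv> real (j choose Suc k)"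
    and "y \<equiv> (case k of 0 \<Rightarrow> 0 | Suc k' \<Rightarrow> real (j choose k'))"
  shows "real (Suc j) * (x * x - y * z) = (x + y) * (x + z)"
proof (cases "k \<le> j")
  case True
  then have d: "real (j - k) = real j - real k" by simp
  have absorb: "Suc m * (j choose Suc m) = (j - m) * (j choose m)" for m
    by (metis binomial_absorb_comp binomial_absorption)
  have 1: "z * (real k + 1) = (real j - real k) * x"
    using arg_cong[OF absorb[of k], of real] d
    by (simp add: z_def x_def algebra_simps)
  have 2: "y * (real j - real k + 1) = real k * x"
  proof (cases k)
    case (Suc m)
    then show ?thesis
      using arg_cong[OF absorb[of m], of real] True
      by (simp add: x_def y_def algebra_simps of_nat_diff)
  qed (simp add: y_def)
  \<comment> \<open>The denominators of \<open>z / x\<close> and \<open>y / x\<close>; they are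
    multiplied in to get a polynomial identity and cancelled afterwards.\<close>
  have pos: "(real k + 1) * (real j - real k + 1) > 0"
    using True by simp
  have "(real k + 1) * (real j - real k + 1) * (real (Suc j) * (x * x - y * z)) =
    (real k + 1) * (real j - real k + 1) * ((x + y) * (x + z))"
    using 1 2 by simp algebra
  with pos show ?thesis
    by (metis mult_left_cancel less_irrefl)
next
  case False
  \<comment> \<open>Here \<open>x\<close> and \<open>z\<close> vanish, though \<open>y\<close> need
    not.\<close>
  then show ?thesis
    by (simp add: x_def y_def z_def binomial_eq_0)
qed

text \<open>From height 0 the first step can only go up, so the closed form at height 1 applies to
  the remaining \<open>j\<close> steps.\<close>

lemma walks_narayana:
  "real (walks (Suc j) (Suc k) 0) =
    1 / real (Suc j) * real (Suc j choose k) * real (Suc j choose Suc k)"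
proof -
  define y where "y = (case k of 0 \<Rightarrow> 0 | Suc k' \<Rightarrow> real (j choose k'))"
  have "real_of_int (int (walks (Suc j) (Suc k) 0)) =
      real (j choose k) * real (j choose k) - y * real (j choose Suc k)"
    using walks_closed[of j k 0] by (cases k) (simp_all add: y_def)
  moreover have "real (Suc j choose k) = real (j choose k) + y"
    by (cases k) (simp_all add: y_def)
  ultimately have "real (Suc j) * real (walks (Suc j) (Suc k) 0) =
      real (Suc j choose k) * real (Suc j choose Suc k)"
    using narayana_eq[of j k, folded y_def] by simp
  then show ?thesis by (simp add: field_simps del: binomial_Suc_Suc)
qed

lemma lazy_walks_narayana:
  assumes "k \<ge> 1"
  shows "real (lazy_walks n k 0) =
    (\<Sum>j = k..n. 1 / real j * real (j choose (k - 1)) * real (j choose k) * real (n choose j))"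
proof -
  obtain l where k: "k = Suc l" using assms by (cases k) auto
  \<comment> \<open>For \<open>j = 0\<close> both sides are zero: \<open>1 / 0 = 0\<close>, and a
    walk without steps has no up-step.\<close>
  have walks: "real (walks j k 0) = 1 / real j * real (j choose (k - 1)) * real (j choose k)" for j
    using walks_narayana[of _ l] by (cases j) (simp_all add: k del: walks.simps(2) binomial_Suc_Suc)
  have "real (lazy_walks n k 0) = (\<Sum>j\<le>n. real (n choose j) * real (walks j k 0))"
    by (simp add: lazy_walks_eq_binomial_transform)
  also have "\<dots> = (\<Sum>j = k..n. real (n choose j) * real (walks j k 0))"
    by (rule sum.mono_neutral_right) (auto simp: walks not_le binomial_eq_0)
  also have "\<dots> = (\<Sum>j = k..n. 1 / real j * real (j choose (k - 1)) * real (j choose k) * real (n choose j))"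
    unfolding walks by (simp only: mult.commute)
  finally show ?thesis .
qed

subsection \<open>Restricted growth words\<close>

text \<open>The rank grows strictly with \<open>key\<close>, and it lies between 1 and
  \<open>card A\<close>. Used both for sites ranked by \<open>key\<close> and for blocks ranked by
  minimum.\<close>

lemma rank_bij_betw:
  fixes key :: "'a \<Rightarrow> 'b::linorder"
  assumes fin: "finite A" and inj: "inj_on key A"
  shows "bij_betw (\<lambda>x. card {y \<in> A. key y \<le> key x}) A {1..card A}"
proof -
  let ?r = "\<lambda>x. card {y \<in> A. key y \<le> key x}"
  have mono: "?r x < ?r y" if "x \<in> A" "y \<in> A" "key x < key y" for x y
  proof (intro psubset_card_mono psubsetI)
    have "y \<in> {z \<in> A. key z \<le> key y} - {z \<in> A. key z \<le> key x}"
      using that by auto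
    then show "{z \<in> A. key z \<le> key x} \<noteq> {z \<in> A. key z \<le> key y}" by blast
  qed (use that fin in auto)
  have inj_r: "inj_on ?r A"
  proof (rule inj_onI)
    fix x y assume "x \<in> A" "y \<in> A" "?r x = ?r y"
    then have "key x = key y"
      using mono[of x y] mono[of y x] by (cases "key x" "key y" rule: linorder_cases) auto
    with inj \<open>x \<in> A\<close> \<open>y \<in> A\<close> show "x = y" by (auto dest: inj_onD)
  qed
  moreover have "?r ` A \<subseteq> {1..card A}"
  proof safe
    fix x assume "x \<in> A"
    then have "{x} \<subseteq> {y \<in> A. key y \<le> key x}" by auto
    then have "card {x} \<le> ?r x" using fin by (intro card_mono) auto
    moreover have "?r x \<le> card A" using fin by (intro card_mono) auto
    ultimately show "?r x \<in> {1..card A}" by simp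
  qed
  ultimately show ?thesis
    unfolding bij_betw_def by (simp add: card_image card_subset_eq)
qed

text \<open>Equivalent to the usual bound of each positive letter by one more than the maximum
  before it; this form directly yields the smaller letters in front of a letter.\<close>

definition rgf :: "nat list \<Rightarrow> bool" where
  "rgf w \<longleftrightarrow> 0 \<notin> set w \<and> (\<forall>p b q. w = p @ b # q \<longrightarrow> {1..<b} \<subseteq> set p)"

lemma rgf_Nil [simp]: "rgf []"
  by (simp add: rgf_def)

lemma rgf_snoc: "rgf (w @ [x]) \<longleftrightarrow> rgf w \<and> 1 \<le> x \<and> {1..<x} \<subseteq> set w"
proof
  assume L: "rgf (w @ [x])"
  have "{1..<b} \<subseteq> set p" if "w = p @ b # q" for p b q
    using L that unfolding rgf_def by (metis append_Cons append_assoc)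
  moreover have "{1..<x} \<subseteq> set w" "0 \<notin> set w" "1 \<le> x"
    using L by (auto simp: rgf_def Suc_le_eq)
  ultimately show "rgf w \<and> 1 \<le> x \<and> {1..<x} \<subseteq> set w"
    by (simp add: rgf_def)
next
  assume R: "rgf w \<and> 1 \<le> x \<and> {1..<x} \<subseteq> set w"
  have "{1..<b} \<subseteq> set p" if "w @ [x] = p @ b # q" for p b q
    using R that by (cases q rule: rev_cases) (auto simp: rgf_def)
  with R show "rgf (w @ [x])"
    by (simp add: rgf_def)
qed

lemma rgf_append: "rgf (v @ w) \<Longrightarrow> rgf v"
  by (induction w rule: rev_induct) (simp_all add: rgf_snoc flip: append_assoc)

lemma rgf_set_Suc:
  assumes "set w = {1..r}"
  shows "rgf (w @ [x]) \<longleftrightarrow> rgf w \<and> x \<in> {1..Suc r}"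
  using assms by (cases x) (auto simp: rgf_snoc atLeastLessThanSuc_atLeastAtMost)

text \<open>Each letter enlarges the initial interval by at most one element. Hence
  \<open>card (set w)\<close> doubles as the maximum of a nonempty word.\<close>

lemma rgf_set:
  assumes "rgf w"
  shows "set w = {1..card (set w)}"
proof -
  have "\<exists>r. set w = {1..r}" using assms
  proof (induction w rule: rev_induct)
    case (snoc x w)
    then obtain r where r: "set w = {1..r}" by (auto simp: rgf_snoc)
    then have "x \<in> {1..r} \<or> x = Suc r"
      using snoc.prems by (auto simp: rgf_set_Suc[OF r])
    then show ?case
    proof
      assume "x \<in> {1..r}"
      then have "set (w @ [x]) = {1..r}" using r by (simp add: insert_absorb)
      then show ?thesis ..
    next
      assume "x = Suc r"
      then have "set (w @ [x]) = {1..Suc r}" using r by (simp add: atLeastAtMostSuc_conv)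
      then show ?thesis ..
    qed
  qed auto
  then obtain r where "set w = {1..r}" ..
  then show ?thesis by simp
qed

text \<open>
  With \<open>key = int\<close> this is containment of \<open>312\<close>, and with \<open>key = (\<lambda>x. - int x)\<close> that of \<open>321\<close>.
\<close>

definition bad :: "(nat \<Rightarrow> int) \<Rightarrow> nat list \<Rightarrow> bool" where
  "bad key w \<longleftrightarrow> (\<exists>c a b. subseq [c, a, b] w \<and> a < c \<and> b < c \<and> key a < key b)"

text \<open>The non-maximal letters that can be appended to \<open>w\<close> without creating a bad triple.\<close>

definition sites :: "(nat \<Rightarrow> int) \<Rightarrow> nat list \<Rightarrow> nat set" where
  "sites key w = {b \<in> {1..<card (set w)}. \<not> (\<exists>c a. subseq [c, a] w \<and> a < c \<and> b < c \<and> key a < key b)}"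

section \<open>Bad triples and sites after appending a letter\<close>

lemma subseq2_snoc: "subseq [c, a] (w @ [x]) \<longleftrightarrow> subseq [c, a] w \<or> (c \<in> set w \<and> a = x)"
  by (induction w) (auto simp: subseq_singleton_left)

lemma subseq3_snoc: "subseq [c, a, b] (w @ [x]) \<longleftrightarrow> subseq [c, a, b] w \<or> (subseq [c, a] w \<and> b = x)"
proof (induction w)
  case (Cons y w)
  then show ?case
    using subseq_Cons'[of c "[a, b]" w] subseq_Cons'[of c "[a]" w]
    by (simp add: subseq2_snoc subseq_singleton_left)
qed simp

lemma bad_append: "bad key v \<Longrightarrow> bad key (v @ w)"
  unfolding bad_def by (blast intro: subseq_rev_drop_many)

lemma bad_snoc:
  "bad key (w @ [x]) \<longleftrightarrow> bad key w \<or> (\<exists>c a. subseq [c, a] w \<and> a < c \<and> x < c \<and> key a < key x)"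
  unfolding bad_def subseq3_snoc by blast

lemma subseq2_set: "subseq [c, a] w \<Longrightarrow> c \<in> set w \<and> a \<in> set w"
  using subseq_append_iff[of "[c]" w "[]"] by (auto elim: list_emb_set)

text \<open>A letter that is at least the maximum of \<open>w\<close> cannot end a bad triple,
  because no earlier letter exceeds it.\<close>

lemma good_snoc_iff:
  assumes "rgf w" "\<not> bad key w" "w \<noteq> []"
  shows "rgf (w @ [x]) \<and> \<not> bad key (w @ [x]) \<longleftrightarrow>
    x \<in> sites key w \<or> x = card (set w) \<or> x = Suc (card (set w))"
proof -
  have "card (set w) \<ge> 1" using assms(3) by (simp add: Suc_le_eq card_gt_0_iff)
  moreover have "c \<le> card (set w)" if "subseq [c, a] w" for c a
    using subseq2_set[OF that] rgf_set[OF assms(1)] atLeastAtMost_iff by blast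
  ultimately show ?thesis
    using assms(1,2) unfolding rgf_set_Suc[OF rgf_set[OF assms(1)]] bad_snoc sites_def
    by (auto simp: le_Suc_eq not_less dest: leD)
qed

lemma sites_snoc_iff:
  "b \<in> sites key (w @ [x]) \<longleftrightarrow> 1 \<le> b \<and> b < card (set (w @ [x])) \<and>
    \<not> (\<exists>c a. subseq [c, a] w \<and> a < c \<and> b < c \<and> key a < key b) \<and>
    \<not> (\<exists>c\<in>set w. x < c \<and> b < c \<and> key x < key b)"
  unfolding sites_def subseq2_snoc mem_Collect_eq atLeastLessThan_iff by blast

lemma card_snoc:
  assumes "rgf w" "w \<noteq> []"
  shows "x \<in> insert (card (set w)) (sites key w) \<Longrightarrow> card (set (w @ [x])) = card (set w)"
    and "card (set (w @ [Suc (card (set w))])) = Suc (card (set w))"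
proof -
  obtain r where r: "set w = {1..r}" using rgf_set[OF assms(1)] by blast
  moreover have "set w \<noteq> {}" using assms(2) by simp
  ultimately have "r \<ge> 1" by simp
  then show "card (set (w @ [x])) = card (set w)" if "x \<in> insert (card (set w)) (sites key w)"
    using that r by (auto simp: sites_def insert_absorb)
  show "card (set (w @ [Suc (card (set w))])) = Suc (card (set w))"
    using r by simp
qed

text \<open>A site \<open>b\<close> is lost only if the new letter \<open>x\<close> completes a pair
  \<open>c, x\<close> with \<open>x < c\<close>, \<open>b < c\<close> and
  \<open>key x < key b\<close>. For \<open>r\<close> and \<open>Suc r\<close> no such
  \<open>c\<close> exists, and \<open>Suc r\<close> turns the old maximum into a site. For a site
  \<open>x\<close>, exactly the sites of larger key are lost.\<close>

lemma sites_snoc: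
  assumes "rgf w" "w \<noteq> []"
  defines "r \<equiv> card (set w)"
  shows "sites key (w @ [r]) = sites key w"
    and "sites key (w @ [Suc r]) = insert r (sites key w)"
    and "x \<in> sites key w \<Longrightarrow> sites key (w @ [x]) = {y \<in> sites key w. key y \<le> key x}"
proof -
  have r: "1 \<le> r" using assms(2) by (simp add: r_def Suc_le_eq card_gt_0_iff)
  have in_w: "c \<in> set w \<longleftrightarrow> 1 \<le> c \<and> c \<le> r" for c
    by (subst rgf_set[OF assms(1)]) (simp add: r_def)
  have le: "c \<le> r" if "subseq [c, a] w" for c a
    using subseq2_set[OF that] in_w by blast
  have sites: "b \<in> sites key w \<longleftrightarrow> 1 \<le> b \<and> b < r \<and>
      \<not> (\<exists>c a. subseq [c, a] w \<and> a < c \<and> b < c \<and> key a < key b)" for b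
    unfolding sites_def r_def by simp
  have old: "card (set (w @ [y])) = r" if "y \<in> insert r (sites key w)" for y
    using card_snoc(1)[OF assms(1,2)] that unfolding r_def by blast
  have new: "card (set (w @ [Suc r])) = Suc r"
    using card_snoc(2)[OF assms(1,2)] unfolding r_def .
  show "sites key (w @ [r]) = sites key w"
  proof (rule set_eqI)
    fix b show "b \<in> sites key (w @ [r]) \<longleftrightarrow> b \<in> sites key w"
      unfolding sites_snoc_iff sites old[OF insertI1] using in_w leD by blast
  qed
  show "sites key (w @ [Suc r]) = insert r (sites key w)"
  proof (rule set_eqI)
    fix b
    have "\<not> (\<exists>c\<in>set w. Suc r < c \<and> b < c \<and> key (Suc r) < key b)"
      using in_w by auto
    moreover have "\<not> (\<exists>c a. subseq [c, a] w \<and> a < c \<and> r < c \<and> key a < key r)"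
      using le leD by blast
    ultimately show "b \<in> sites key (w @ [Suc r]) \<longleftrightarrow> b \<in> insert r (sites key w)"
      unfolding sites_snoc_iff insert_iff sites new less_Suc_eq using r by blast
  qed
  show "sites key (w @ [x]) = {y \<in> sites key w. key y \<le> key x}" if x: "x \<in> sites key w"
  proof (rule set_eqI)
    fix b
    have "x < r" using x sites by blast
    \<comment> \<open>The witness is \<open>c = r\<close>, which occurs in \<open>w\<close> and
      exceeds both \<open>x\<close> and \<open>b\<close>.\<close>
    then have key: "(\<exists>c\<in>set w. x < c \<and> b < c \<and> key x < key b) \<longleftrightarrow> key x < key b" if "b < r"
      using that in_w r by blast
    show "b \<in> sites key (w @ [x]) \<longleftrightarrow> b \<in> {y \<in> sites key w. key y \<le> key x}"
    proof (cases "b < r")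
      case True
      show ?thesis
        unfolding sites_snoc_iff mem_Collect_eq sites old[OF insertI2[OF x]] key[OF True] not_less
        by (simp only: conj_assoc)
    next
      case False
      then show ?thesis
        unfolding sites_snoc_iff mem_Collect_eq sites old[OF insertI2[OF x]] by simp
    qed
  qed
qed

section \<open>Counting the good extensions of a word\<close>

definition extensions :: "(nat \<Rightarrow> int) \<Rightarrow> nat list \<Rightarrow> nat \<Rightarrow> nat \<Rightarrow> nat list set" where
  "extensions key w n k = {v. length v = n \<and> rgf (w @ v) \<and> \<not> bad key (w @ v) \<and>
     card (set (w @ v)) = card (set w) + k}"

lemma finite_sites [simp]: "finite (sites key w)"
  by (simp add: sites_def)

text \<open>The first appended letter is the first step of the walk; \<open>k\<close> counts new
  maxima, that is, up-steps. Other letters are excluded because prefixes of good words are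
  good.\<close>

lemma extensions_Suc:
  assumes "rgf w" "\<not> bad key w" "w \<noteq> []"
  defines "r \<equiv> card (set w)"
  shows "extensions key w (Suc n) k =
    (\<Union>x\<in>insert r (sites key w). (#) x ` extensions key (w @ [x]) n k) \<union>
    (case k of 0 \<Rightarrow> {} | Suc k' \<Rightarrow> (#) (Suc r) ` extensions key (w @ [Suc r]) n k')" (is "_ = ?R")
proof (intro set_eqI)
  have old: "card (set (w @ [x])) = r" if "x \<in> insert r (sites key w)" for x
    using card_snoc(1)[OF assms(1,3)] that unfolding r_def by blast
  have new: "card (set (w @ [Suc r])) = Suc r"
    using card_snoc(2)[OF assms(1,3)] unfolding r_def .
  fix v
  show "v \<in> extensions key w (Suc n) k \<longleftrightarrow> v \<in> ?R"
  proof (cases v)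
    case Nil
    then show ?thesis by (auto simp: extensions_def split: nat.split)
  next
    case (Cons x u)
    have app: "w @ x # u = (w @ [x]) @ u" by simp
    have mem: "v \<in> extensions key w (Suc n) k \<longleftrightarrow> length u = n \<and> rgf ((w @ [x]) @ u) \<and>
      \<not> bad key ((w @ [x]) @ u) \<and> card (set ((w @ [x]) @ u)) = r + k"
      unfolding extensions_def Cons r_def by simp
    consider "x \<in> insert r (sites key w)" | "x = Suc r" | "\<not> (rgf (w @ [x]) \<and> \<not> bad key (w @ [x]))"
      using good_snoc_iff[OF assms(1-3), of x] unfolding r_def by blast
    then show ?thesis
    proof cases
      case 1
      then have "x \<noteq> Suc r" by (auto simp: sites_def r_def)
      then have R: "v \<in> ?R \<longleftrightarrow> u \<in> extensions key (w @ [x]) n k"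
        using 1 unfolding Cons by (auto split: nat.splits)
      show ?thesis
        unfolding mem R unfolding extensions_def mem_Collect_eq old[OF 1] ..
    next
      case 2
      then have "x \<notin> insert r (sites key w)" by (auto simp: sites_def r_def)
      then have R: "v \<in> ?R \<longleftrightarrow> (\<exists>k'. k = Suc k' \<and> u \<in> extensions key (w @ [x]) n k')"
        using 2 unfolding Cons by (auto split: nat.splits)
      \<comment> \<open>The letter \<open>Suc r\<close> is already a new maximum, which rules out
        \<open>k = 0\<close>.\<close>
      have "card (set (w @ [x])) \<le> card (set ((w @ [x]) @ u))"
        by (intro card_mono) auto
      then have "Suc r \<le> card (set ((w @ [x]) @ u))"
        using new 2 by simp
      then show ?thesis
        unfolding mem R unfolding extensions_def mem_Collect_eq 2 new by (cases k) auto
    next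
      case 3
      then have no: "\<not> (rgf ((w @ [x]) @ u) \<and> \<not> bad key ((w @ [x]) @ u))"
        using rgf_append bad_append by blast
      moreover have "x \<notin> insert r (sites key w)" "x \<noteq> Suc r"
        using 3 good_snoc_iff[OF assms(1-3), of x] unfolding r_def by blast+
      ultimately show ?thesis
        unfolding mem unfolding Cons by (auto split: nat.splits)
    qed
  qed
qed

text \<open>The count depends on \<open>w\<close> only through its number of sites, the height of
  the walk. Injectivity of \<open>key\<close> makes the ranks of the sites run through
  \<open>1, ..., card S\<close>.\<close>

lemma card_extensions:
  assumes "inj key" "rgf w" "\<not> bad key w" "w \<noteq> []"
  shows "finite (extensions key w n k) \<and> card (extensions key w n k) = lazy_walks n k (card (sites key w))"
  using assms(2-4)
proof (induction n arbitrary: w k)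
  case 0
  then have "extensions key w 0 k = (if k = 0 then {[]} else {})"
    by (auto simp: extensions_def)
  then show ?case by simp
next
  case (Suc n)
  define r where "r = card (set w)"
  define S where "S = sites key w"
  have IH: "finite (extensions key (w @ [x]) n k) \<and>
      card (extensions key (w @ [x]) n k) = lazy_walks n k (card (sites key (w @ [x])))"
    if "x \<in> insert (Suc r) (insert r S)" for x k
  proof -
    have "rgf (w @ [x]) \<and> \<not> bad key (w @ [x])"
      using good_snoc_iff[OF Suc.prems, of x] that unfolding r_def S_def by blast
    then show ?thesis using Suc.IH by blast
  qed
  note snoc = sites_snoc[OF Suc.prems(1,3), where key = key, folded r_def S_def]
  have S: "finite S" "r \<notin> S" "Suc r \<notin> S" by (auto simp: S_def r_def sites_def)
  define U where "U = (\<Union>x\<in>insert r S. (#) x ` extensions key (w @ [x]) n k)"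
  define V where "V = (case k of 0 \<Rightarrow> {} | Suc k' \<Rightarrow> (#) (Suc r) ` extensions key (w @ [Suc r]) n k')"
  have "card U = (\<Sum>x\<in>insert r S. card ((#) x ` extensions key (w @ [x]) n k))"
    unfolding U_def using S IH by (intro card_UN_disjoint) auto
  also have "\<dots> = (\<Sum>x\<in>insert r S. lazy_walks n k (card (sites key (w @ [x]))))"
    using IH by (intro sum.cong) (auto simp: card_image)
  also have "\<dots> = lazy_walks n k (card S) + (\<Sum>x\<in>S. lazy_walks n k (card {y \<in> S. key y \<le> key x}))"
    using S by (simp add: snoc)
  \<comment> \<open>appending the site of rank \<open>i\<close> leaves exactly \<open>i\<close> sites\<close>
  also have "(\<Sum>x\<in>S. lazy_walks n k (card {y \<in> S. key y \<le> key x})) = (\<Sum>i=1..card S. lazy_walks n k i)"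
    using S(1) assms(1) by (intro sum.reindex_bij_betw rank_bij_betw) (auto intro: inj_on_subset)
  finally have U: "card U = lazy_walks n k (card S) + (\<Sum>i=1..card S. lazy_walks n k i)" .
  have V: "card V = (case k of 0 \<Rightarrow> 0 | Suc k' \<Rightarrow> lazy_walks n k' (Suc (card S)))"
    using IH S by (auto simp: V_def snoc card_image split: nat.split)
  have fin: "finite U" "finite V"
    unfolding U_def V_def using S IH by (auto split: nat.split)
  have "U \<inter> V = {}"
    unfolding U_def V_def using S by (auto split: nat.splits)
  moreover have "extensions key w (Suc n) k = U \<union> V"
    unfolding extensions_Suc[OF Suc.prems, folded r_def S_def] U_def V_def ..
  ultimately show ?case
    using fin U V by (simp add: card_Un_disjoint flip: S_def)
qed

text \<open>Every nonempty restricted growth word begins with 1, and \<open>[1]\<close> has no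
  sites, so the walk starts at height 0 with \<open>n\<close> letters and \<open>k\<close> new
  maxima to come.\<close>

lemma card_good_words:
  assumes "inj key"
  shows "card {w. length w = n + 1 \<and> rgf w \<and> \<not> bad key w \<and> card (set w) = k + 1} = lazy_walks n k 0"
proof -
  have one: "rgf [1]" "\<not> bad key [1]"
    using rgf_snoc[of "[]" 1] by (auto simp: bad_def)
  have "hd w = 1" if "rgf w" "w \<noteq> []" for w
    using that rgf_append[of "[hd w]" "tl w"] rgf_snoc[of "[]" "hd w"]
    by (cases w) (auto simp: atLeastLessThan_empty_iff)
  then have "{w. length w = n + 1 \<and> rgf w \<and> \<not> bad key w \<and> card (set w) = k + 1} =
      (#) 1 ` extensions key [1] n k"
    by (fastforce simp: extensions_def length_Suc_conv)
  then have "card {w. length w = n + 1 \<and> rgf w \<and> \<not> bad key w \<and> card (set w) = k + 1} =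
      card (extensions key [1] n k)"
    by (simp add: card_image)
  also have "\<dots> = lazy_walks n k (card (sites key [1]))"
    using card_extensions[OF assms one] by simp
  also have "sites key [1] = {}" by (simp add: sites_def)
  finally show ?thesis by simp
qed

subsection \<open>Canonical words of partitions\<close>

lemma rgf_prefix:
  assumes "rgf w" "l < length w" "1 \<le> a" "a < w ! l"
  shows "\<exists>i<l. w ! i = a"
proof -
  have "w = take l w @ w ! l # drop (Suc l) w"
    using assms(2) by (rule id_take_nth_drop)
  then have "a \<in> set (take l w)"
    using assms by (metis (no_types) rgf_def atLeastLessThan_iff subsetD)
  then show ?thesis
    using assms(2) by (auto simp: in_set_conv_nth)
qed

lemma rgfI:
  assumes "0 \<notin> set w" "\<And>l a. l < length w \<Longrightarrow> 1 \<le> a \<Longrightarrow> a < w ! l \<Longrightarrow> \<exists>i<l. w ! i = a"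
  shows "rgf w"
  unfolding rgf_def
proof (intro conjI allI impI subsetI)
  fix p b q a
  assume w: "w = p @ b # q" and a: "a \<in> {1..<b}"
  have "\<exists>i<length p. w ! i = a"
    using assms(2)[of "length p" a] w a by auto
  then show "a \<in> set p" using w by (auto simp: nth_append)
qed (rule assms(1))

lemma length_canonical_word [simp]: "length (canonical_word m P) = m"
  by (simp add: canonical_word_def del: upt_Suc)

lemma canonical_word_partition:
  assumes P: "partition_on {1..m} P"
  defines "w \<equiv> canonical_word m P"
  shows "bij_betw (block_index P) P {1..card P}"
    and "\<And>i B. B \<in> P \<Longrightarrow> i \<in> B \<Longrightarrow> w ! (i - 1) = block_index P B"
    and "length w = m" and "set w = {1..card P}" and "rgf w"
proof -
  have fP: "finite P" using finite_elements[OF _ P] by simp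
  have block: "finite B" "B \<noteq> {}" "B \<subseteq> {1..m}" if "B \<in> P" for B
    using that P by (auto simp: partition_on_def intro: finite_subset)
  have Min_in: "Min B \<in> B" if "B \<in> P" for B
    using block[OF that] by simp
  have unique: "B = C" if "B \<in> P" "C \<in> P" "i \<in> B" "i \<in> C" for B C i
    using that P by (auto simp: partition_on_def disjoint_def)
  have "inj_on Min P"
    by (rule inj_onI) (metis Min_in unique)
  then show bij: "bij_betw (block_index P) P {1..card P}"
    using rank_bij_betw[OF fP, of Min] unfolding block_index_def by blast
  show len: "length w = m" by (simp add: w_def)
  show nth: "w ! (i - 1) = block_index P B" if "B \<in> P" "i \<in> B" for i B
  proof -
    have "(THE C. C \<in> P \<and> i \<in> C) = B"
      using that unique by (intro the_equality) auto
    moreover have "i \<in> {1..m}" using block(3) that by blast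
    ultimately show ?thesis
      unfolding w_def canonical_word_def by (subst nth_map_upt) auto
  qed
  have ex: "\<exists>B\<in>P. Suc l \<in> B \<and> w ! l = block_index P B" if "l < m" for l
  proof -
    have "Suc l \<in> \<Union>P" using that P by (auto simp: partition_on_def)
    then show ?thesis using nth[of _ "Suc l"] by auto
  qed
  have idx_in: "block_index P B \<in> {1..card P}" if "B \<in> P" for B
    using bij that by (rule bij_betw_apply)
  show set: "set w = {1..card P}"
  proof
    show "set w \<subseteq> {1..card P}"
      using ex idx_in len by (fastforce simp: in_set_conv_nth)
    show "{1..card P} \<subseteq> set w"
    proof
      fix a assume "a \<in> {1..card P}"
      then have "a \<in> block_index P ` P"
        by (simp only: bij_betw_imp_surj_on[OF bij])
      then obtain A where A: "A \<in> P" "block_index P A = a" by blast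
      \<comment> \<open>The letter \<open>a\<close> is found at the minimum of its block; element
        \<open>i\<close> sits at list position \<open>i - 1\<close>.\<close>
      have "Min A \<in> {1..m}" using Min_in block(3) A by blast
      then have "Min A - 1 < length w" using len by auto
      from nth_mem[OF this] show "a \<in> set w"
        unfolding nth[OF A(1) Min_in[OF A(1)]] A(2) .
    qed
  qed
  show "rgf w"
  proof (rule rgfI)
    show "0 \<notin> set w" using set by simp
    fix l a assume l: "l < length w" and a: "1 \<le> a" "a < w ! l"
    obtain B where B: "B \<in> P" "Suc l \<in> B" "w ! l = block_index P B"
      using ex l len by auto
    have "a \<in> {1..card P}" using a idx_in[OF B(1)] B(3) by simp
    then have "a \<in> block_index P ` P"
      by (simp only: bij_betw_imp_surj_on[OF bij])
    then obtain A where A: "A \<in> P" "block_index P A = a" by blast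
    \<comment> \<open>A smaller index forces a smaller minimum, so \<open>a\<close> occurs before
      position \<open>l\<close>.\<close>
    have "Min A < Min B"
    proof (rule ccontr)
      assume "\<not> Min A < Min B"
      then have "block_index P B \<le> block_index P A"
        unfolding block_index_def using fP by (intro card_mono) auto
      with a A B show False by simp
    qed
    also have "Min B \<le> Suc l" using B block by simp
    finally have "Min A - 1 < l"
      using Min_in[OF A(1)] block(3)[OF A(1)] by fastforce
    then show "\<exists>i<l. w ! i = a" using nth[OF A(1) Min_in[OF A(1)]] A(2) by blast
  qed
qed

text \<open>Distinct blocks have distinct indices, so each block is the fibre of its index. Hence
  the word determines the partition.\<close>

lemma partition_eq_fibres:
  assumes P: "partition_on {1..m} P"
  shows "P = (\<lambda>j. {i \<in> {1..m}. canonical_word m P ! (i - 1) = j}) ` set (canonical_word m P)"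
proof -
  note cw = canonical_word_partition[OF P]
  have fibre: "{i \<in> {1..m}. canonical_word m P ! (i - 1) = block_index P B} = B" if B: "B \<in> P" for B
  proof (intro equalityI subsetI)
    fix i assume i: "i \<in> {i \<in> {1..m}. canonical_word m P ! (i - 1) = block_index P B}"
    then have "i \<in> {1..m}" by simp
    then have "i \<in> \<Union>P" using partition_onD1[OF P] by blast
    then obtain C where C: "C \<in> P" "i \<in> C" by blast
    then have "block_index P C = block_index P B" using cw(2)[OF C] i by simp
    then have "C = B" using cw(1) B C by (auto simp: bij_betw_def dest: inj_onD)
    with C show "i \<in> B" by simp
  next
    fix i assume i: "i \<in> B"
    then have "i \<in> {1..m}" using B P by (auto simp: partition_on_def)
    with cw(2)[OF B i] show "i \<in> {i \<in> {1..m}. canonical_word m P ! (i - 1) = block_index P B}" by simp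
  qed
  have "set (canonical_word m P) = block_index P ` P"
    using cw(1,4) by (simp add: bij_betw_def)
  then show ?thesis using fibre by (simp add: image_image)
qed

text \<open>The fibres of \<open>w\<close> form the partition. The growth condition orders their
  minima by letter, so block indices reproduce the letters.\<close>

lemma canonical_word_surj:
  assumes w: "rgf w" "length w = m"
  shows "\<exists>P. partition_on {1..m} P \<and> canonical_word m P = w"
proof -
  define r where "r = card (set w)"
  have set: "set w = {1..r}" unfolding r_def using w(1) by (rule rgf_set)
  define B where "B j = {i \<in> {1..m}. w ! (i - 1) = j}" for j
  have in_B: "w ! (i - 1) \<in> {1..r}" if "i \<in> {1..m}" for i
  proof -
    have "i - 1 < length w" using that w(2) by auto
    then show ?thesis using set nth_mem by metis
  qed
  have ne: "B j \<noteq> {}" if "j \<in> {1..r}" for j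
  proof -
    obtain l where "l < m" "w ! l = j"
      using \<open>j \<in> {1..r}\<close> set w(2) by (metis in_set_conv_nth)
    then have "Suc l \<in> B j" by (simp add: B_def)
    then show ?thesis by blast
  qed
  have part: "partition_on {1..m} (B ` {1..r})"
  proof (rule partition_onI)
    show "\<Union> (B ` {1..r}) = {1..m}" using in_B by (auto simp: B_def)
    show "{} \<notin> B ` {1..r}" using ne by blast
  qed (auto simp: B_def disjnt_def)
  have bij: "bij_betw B {1..r} (B ` {1..r})"
  proof (rule inj_on_imp_bij_betw, rule inj_onI)
    fix a b assume a: "a \<in> {1..r}" "b \<in> {1..r}" "B a = B b"
    obtain i where "i \<in> B a" using ne a by blast
    then show "a = b" using a(3) by (auto simp: B_def)
  qed
  have ordered: "Min (B a) < Min (B b)" if "a \<in> {1..r}" "b \<in> {1..r}" "a < b" for a b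
  proof -
    have fin: "finite (B j)" for j by (simp add: B_def)
    have "Min (B b) \<in> B b" using ne fin that by (intro Min_in) auto
    then have b: "Min (B b) \<in> {1..m}" "w ! (Min (B b) - 1) = b" by (auto simp: B_def)
    \<comment> \<open>Even the first occurrence of \<open>b\<close> is preceded by the smaller
      letter \<open>a\<close>.\<close>
    have "\<exists>i<Min (B b) - 1. w ! i = a"
    proof (rule rgf_prefix[OF w(1)])
      show "Min (B b) - 1 < length w" using b(1) w(2) by auto
    qed (use that b(2) in auto)
    then obtain i where i: "i < Min (B b) - 1" "w ! i = a" by blast
    then have "Suc i \<in> B a" using b by (auto simp: B_def)
    then have "Min (B a) \<le> Suc i" using fin by simp
    with i show ?thesis by simp
  qed
  have "canonical_word m (B ` {1..r}) = w"
  proof (rule nth_equalityI)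
    show "length (canonical_word m (B ` {1..r})) = length w"
      using w(2) by simp
    fix l assume "l < length (canonical_word m (B ` {1..r}))"
    then have l: "Suc l \<in> {1..m}" by simp
    then have "Suc l \<in> B (w ! l)" by (simp add: B_def)
    moreover have "w ! l \<in> {1..r}" using in_B[OF l] by simp
    ultimately show "canonical_word m (B ` {1..r}) ! l = w ! l"
      using canonical_word_nth[OF part bij ordered l, of "w ! l"] by simp
  qed
  with part show ?thesis by blast
qed

lemma card_avoiding_partitions:
  "card (avoiding_partitions \<tau> m r) = card {w. length w = m \<and> rgf w \<and> avoids w \<tau> \<and> card (set w) = r}"
proof (rule bij_betw_same_card)
  show "bij_betw (canonical_word m) (avoiding_partitions \<tau> m r)
     {w. length w = m \<and> rgf w \<and> avoids w \<tau> \<and> card (set w) = r}"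
    unfolding bij_betw_def
  proof (intro conjI equalityI subsetI)
    show "inj_on (canonical_word m) (avoiding_partitions \<tau> m r)"
    proof (rule inj_onI)
      fix P Q assume eq: "canonical_word m P = canonical_word m Q"
        and "P \<in> avoiding_partitions \<tau> m r" "Q \<in> avoiding_partitions \<tau> m r"
      then have "partition_on {1..m} P" "partition_on {1..m} Q"
        by (simp_all add: avoiding_partitions_def)
      from this[THEN partition_eq_fibres] show "P = Q"
        unfolding eq by (rule trans[OF _ sym])
    qed
  next
    fix w assume "w \<in> canonical_word m ` avoiding_partitions \<tau> m r"
    then show "w \<in> {w. length w = m \<and> rgf w \<and> avoids w \<tau> \<and> card (set w) = r}"
      using canonical_word_partition(3-5) by (auto simp: avoiding_partitions_def)
  next
    fix w assume w: "w \<in> {w. length w = m \<and> rgf w \<and> avoids w \<tau> \<and> card (set w) = r}"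
    then obtain P where P: "partition_on {1..m} P" "canonical_word m P = w"
      using canonical_word_surj by blast
    then have "card P = r" using w canonical_word_partition(4)[OF P(1)] by simp
    with P w show "w \<in> canonical_word m ` avoiding_partitions \<tau> m r"
      by (auto simp: avoiding_partitions_def)
  qed
qed

text \<open>Smaller letters of a restricted growth word come for free in front of any letter.\<close>

lemma rgf_subseq:
  assumes "rgf w" "subseq (c # u) w" "1 \<le> a" "a < b" "b < c"
  shows "subseq (a # b # c # u) w"
proof -
  obtain p q where w: "w = p @ c # q" and u: "subseq u q"
    using list_emb_ConsD[OF assms(2)] by blast
  have "{1..<c} \<subseteq> set p" using assms(1) w by (auto simp: rgf_def)
  then have "b \<in> set p" using assms by auto
  then obtain s t where p: "p = s @ b # t" by (meson split_list)
  have "{1..<b} \<subseteq> set s" using assms(1) w p by (auto simp: rgf_def)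
  then have "a \<in> set s" using assms by auto
  then have "subseq [a] s" by (simp add: subseq_singleton_left)
  moreover have "subseq (b # c # u) (b # t @ c # q)" using u by (simp add: subseq_drop_many)
  ultimately show ?thesis
    unfolding w p using list_emb_append_mono[of "(=)" "[a]" s "b # c # u" "b # t @ c # q"] by simp
qed

section \<open>From the five-letter patterns to bad triples\<close>

lemma order_isomorphic_12312:
  "order_isomorphic u [1, 2, 3, 1, 2] \<longleftrightarrow> (\<exists>a b c. u = [a, b, c, a, b] \<and> a < b \<and> b < c)" (is "?L \<longleftrightarrow> ?R")
proof
  assume L: ?L
  then obtain a b c d e where "u = [a, b, c, d, e]"
    by (auto simp: order_isomorphic_def length_Suc_conv numeral_eq_Suc)
  \<comment> \<open>Equal pattern letters force equal letters of \<open>u\<close>, since neither may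
    lie below the other.\<close>
  with L show ?R
    by (simp add: order_isomorphic_def numeral_eq_Suc All_less_Suc)
next
  assume ?R
  then show ?L
    by (elim exE conjE) (simp add: order_isomorphic_def numeral_eq_Suc All_less_Suc)
qed

lemma order_isomorphic_12321:
  "order_isomorphic u [1, 2, 3, 2, 1] \<longleftrightarrow> (\<exists>a b c. u = [a, b, c, b, a] \<and> a < b \<and> b < c)" (is "?L \<longleftrightarrow> ?R")
proof
  assume L: ?L
  then obtain a b c d e where "u = [a, b, c, d, e]"
    by (auto simp: order_isomorphic_def length_Suc_conv numeral_eq_Suc)
  with L show ?R
    by (simp add: order_isomorphic_def numeral_eq_Suc All_less_Suc)
next
  assume ?R
  then show ?L
    by (elim exE conjE) (simp add: order_isomorphic_def numeral_eq_Suc All_less_Suc)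
qed

text \<open>Dropping the first two letters of an occurrence leaves a bad triple; conversely
  \<open>rgf_subseq\<close> supplies these two letters in front of \<open>c\<close>.\<close>

lemma avoids_12312_iff:
  assumes "rgf w"
  shows "avoids w [1, 2, 3, 1, 2] \<longleftrightarrow> \<not> bad int w"
proof -
  have iff: "subseq [a, b, c, a, b] w \<and> a < b \<and> b < c \<longleftrightarrow>
      subseq [c, a, b] w \<and> a < c \<and> b < c \<and> int a < int b" for a b c
  proof
    assume "subseq [a, b, c, a, b] w \<and> a < b \<and> b < c"
    then show "subseq [c, a, b] w \<and> a < c \<and> b < c \<and> int a < int b"
      using subseq_Cons'[OF subseq_Cons', of a b "[c, a, b]" w] by simp
  next
    assume R: "subseq [c, a, b] w \<and> a < c \<and> b < c \<and> int a < int b"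
    then have "a \<in> set w"
      using subseq_Cons'[of c "[a, b]" w] subseq2_set[of a b w] by blast
    then have "1 \<le> a"
      using assms unfolding rgf_def by (metis less_one not_le)
    then show "subseq [a, b, c, a, b] w \<and> a < b \<and> b < c"
      using R rgf_subseq[OF assms, of c "[a, b]" a b] by simp
  qed
  have "avoids w [1, 2, 3, 1, 2] \<longleftrightarrow>
      \<not> (\<exists>a b c. subseq [a, b, c, a, b] w \<and> a < b \<and> b < c)"
    unfolding avoids_def order_isomorphic_12312 by blast
  then show ?thesis
    unfolding iff bad_def by blast
qed

lemma avoids_12321_iff:
  assumes "rgf w"
  shows "avoids w [1, 2, 3, 2, 1] \<longleftrightarrow> \<not> bad (\<lambda>x. - int x) w"
proof -
  \<comment> \<open>The bad triple is now \<open>c, b, a\<close>: its last two letters decrease,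
    which the negated key turns into an increase.\<close>
  have iff: "subseq [a, b, c, b, a] w \<and> a < b \<and> b < c \<longleftrightarrow>
      subseq [c, b, a] w \<and> b < c \<and> a < c \<and> - int b < - int a" for a b c
  proof
    assume "subseq [a, b, c, b, a] w \<and> a < b \<and> b < c"
    then show "subseq [c, b, a] w \<and> b < c \<and> a < c \<and> - int b < - int a"
      using subseq_Cons'[OF subseq_Cons', of a b "[c, b, a]" w] by simp
  next
    assume R: "subseq [c, b, a] w \<and> b < c \<and> a < c \<and> - int b < - int a"
    then have "a \<in> set w"
      using subseq_Cons'[of c "[b, a]" w] subseq2_set[of b a w] by blast
    then have "1 \<le> a"
      using assms unfolding rgf_def by (metis less_one not_le)
    then show "subseq [a, b, c, b, a] w \<and> a < b \<and> b < c"
      using R rgf_subseq[OF assms, of c "[b, a]" a b] by simp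
  qed
  have "avoids w [1, 2, 3, 2, 1] \<longleftrightarrow>
      \<not> (\<exists>a b c. subseq [a, b, c, b, a] w \<and> a < b \<and> b < c)"
    unfolding avoids_def order_isomorphic_12321 by blast
  then show ?thesis
    unfolding iff bad_def by blast
qed

lemma card_avoiding_partitions_lazy_walks:
  assumes "inj key" "\<And>w. rgf w \<Longrightarrow> avoids w \<tau> \<longleftrightarrow> \<not> bad key w"
  shows "card (avoiding_partitions \<tau> (n + 1) (k + 1)) = lazy_walks n k 0"
proof -
  have "card (avoiding_partitions \<tau> (n + 1) (k + 1)) =
      card {w. length w = n + 1 \<and> rgf w \<and> \<not> bad key w \<and> card (set w) = k + 1}"
    unfolding card_avoiding_partitions using assms(2) by (intro arg_cong[where f = card]) blast
  then show ?thesis using card_good_words[OF assms(1)] by simp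
qed

theorem corollary7:
  fixes n k :: nat
  assumes "k \<ge> 1"
  shows "real (card (avoiding_partitions [1, 2, 3, 1, 2] (n + 1) (k + 1))) =
           (\<Sum>j = k..n. 1 / real j * real (j choose (k - 1)) * real (j choose k) * real (n choose j)) \<and>
         real (card (avoiding_partitions [1, 2, 3, 2, 1] (n + 1) (k + 1))) =
           (\<Sum>j = k..n. 1 / real j * real (j choose (k - 1)) * real (j choose k) * real (n choose j))"
proof
  have "card (avoiding_partitions [1, 2, 3, 1, 2] (n + 1) (k + 1)) = lazy_walks n k 0"
    by (rule card_avoiding_partitions_lazy_walks[OF _ avoids_12312_iff]) (simp_all add: inj_def)
  then show "real (card (avoiding_partitions [1, 2, 3, 1, 2] (n + 1) (k + 1))) =
      (\<Sum>j = k..n. 1 / real j * real (j choose (k - 1)) * real (j choose k) * real (n choose j))"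
    using lazy_walks_narayana[OF assms] by simp
  have "card (avoiding_partitions [1, 2, 3, 2, 1] (n + 1) (k + 1)) = lazy_walks n k 0"
    by (rule card_avoiding_partitions_lazy_walks[OF _ avoids_12321_iff]) (simp_all add: inj_def)
  then show "real (card (avoiding_partitions [1, 2, 3, 2, 1] (n + 1) (k + 1))) =
      (\<Sum>j = k..n. 1 / real j * real (j choose (k - 1)) * real (j choose k) * real (n choose j))"
    using lazy_walks_narayana[OF assms] by simp
qed

end
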